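(* Let $P_1,\ldots,P_r$ be $d$-dimensional polytopes in $\mathbb{R}^d$ that are relatively in general position, and let $P=P_1+\cdots+P_r$ be their Minkowski sum. Then $$\sum_{k=0}^{d-1}(-1)^k\, k\, f^\delta_k(P) = 0.$$
   Context: For a polytope $Q$, $f_k(Q)$ denotes the number of $k$-dimensional faces of $Q$ (including $Q$ itself). Every nonempty face $F$ of a Minkowski sum $P=P_1+\cdots+P_r$ can be written uniquely as $F=F_1+\cdots+F_r$ with $F_i$ a nonempty face of $P_i$; this is called the decomposition of $F$. The decomposition is exact if $\dim(F)=\dim(F_1)+\cdots+\dim(F_r)$. The polytopes $P_1,\ldots,P_r$ are relatively in general position if every facet of $P_1+\cdots+P_r$ has an exact decomposition. For a nonempty face $F$ of $P$ with decomposition $F=F_1+\cdots+F_r$, set $f^\delta_k(F)=f_k(F)-(f_k(F_1)+\cdots+f_k(F_r))$. In particular $f^\delta_k(P)=f_k(P)-(f_k(P_1)+\cdots+f_k(P_r))$. *)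

theory Defs
  imports "HOL-Analysis.Analysis" "HOL-Library.Set_Algebras"
begin

text \<open>
  Minkowski sums are the pointwise sums of sets from \<^theory>\<open>HOL-Library.Set_Algebras\<close>,
  and the dimension of a polytope is its affine dimension \<^const>\<open>aff_dim\<close>.
  Since \<^const>\<open>face_of\<close> admits the empty set (of affine dimension \<open>- 1\<close>) and, for convex sets,
  the set itself, only the empty face escapes the counts below.
\<close>

definition face_count :: "nat \<Rightarrow> 'a::euclidean_space set \<Rightarrow> nat"
  where "face_count k Q = card {F. F face_of Q \<and> aff_dim F = int k}"

definition decomposition ::
    "nat \<Rightarrow> (nat \<Rightarrow> 'a::euclidean_space set) \<Rightarrow> 'a set \<Rightarrow> (nat \<Rightarrow> 'a set) \<Rightarrow> bool"
  where "decomposition r P F G \<longleftrightarrow>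
    (\<forall>i\<in>{1..r}. G i face_of P i \<and> G i \<noteq> {}) \<and> F = (\<Sum>i\<in>{1..r}. G i)"

definition exact_decomposition ::
    "nat \<Rightarrow> (nat \<Rightarrow> 'a::euclidean_space set) \<Rightarrow> 'a set \<Rightarrow> (nat \<Rightarrow> 'a set) \<Rightarrow> bool"
  where "exact_decomposition r P F G \<longleftrightarrow>
    decomposition r P F G \<and> aff_dim F = (\<Sum>i\<in>{1..r}. aff_dim (G i))"

text \<open>
  On the indices \<open>1, \<dots>, r\<close> a decomposition of a face of a Minkowski sum of polytopes is unique,
  so asking for some exact decomposition is the same as asking for the decomposition to be exact.
\<close>

definition relatively_in_general_position :: "nat \<Rightarrow> (nat \<Rightarrow> 'a::euclidean_space set) \<Rightarrow> bool"
  where "relatively_in_general_position r P \<longleftrightarrow>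
    (\<forall>F. F facet_of (\<Sum>i\<in>{1..r}. P i) \<longrightarrow> (\<exists>G. exact_decomposition r P F G))"

text \<open>
  For a face \<open>F\<close> with decomposition \<open>G\<close>, the term \<open>f_delta r k F G\<close> stands for
  $f^\delta_k(F)$.  The decomposition is passed explicitly; the one of \<open>P 1 + \<dots> + P r\<close> itself
  is the family \<open>P\<close>.
\<close>

definition f_delta ::
    "nat \<Rightarrow> nat \<Rightarrow> 'a::euclidean_space set \<Rightarrow> (nat \<Rightarrow> 'a set) \<Rightarrow> int"
  where "f_delta r k F G = int (face_count k F) - (\<Sum>i\<in>{1..r}. int (face_count k (G i)))"

lemma decomposition_self:
  assumes "\<And>i. i \<in> {1..r} \<Longrightarrow> convex (P i)" "\<And>i. i \<in> {1..r} \<Longrightarrow> P i \<noteq> {}"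
  shows "decomposition r P (\<Sum>i\<in>{1..r}. P i) P"
  using assms by (simp add: decomposition_def face_of_refl)

end

theory Submission
  imports Defs
begin

text \<open>
  For a linear functional \<open>c\<close>, the points of a polytope \<open>Q\<close> at which \<open>c\<close> is maximal form a face of
  \<open>Q\<close>, and every nonempty face arises in this way. The functionals that single out one
  face \<open>G\<close> form the relative interior of its normal cone, a relatively open convex set of dimension
  \<open>d - dim G\<close>. Maximisation over a Minkowski sum is done summand by summand, so the face \<open>F\<close> of
  \<open>P = P 1 + \<dots> + P r\<close> selected by \<open>c\<close> determines the faces \<open>F i\<close> of the summands selected by \<open>c\<close>; in
  other words, the normal fan of \<open>P\<close> refines the normal fan of every \<open>P i\<close>.

  The Euler characteristic turns this refinement into a counting identity. If a relatively open
  convex set \<open>U\<close> is cut by a hyperplane, then the signs \<open>(-1) ^ dim\<close> of the pieces add up to the sign of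
  \<open>U\<close>; iterating this, the same holds for every partition of \<open>U\<close> into relatively open convex sets
  each of which is determined by finitely many hyperplanes (\<open>euler_sign_partition\<close>).
  Applied to the normal region of a face \<open>G\<close> of \<open>P i\<close>, it gives
  \<open>(\<Sum>F | F i = G. (-1) ^ dim F) = (-1) ^ dim G\<close>
  (\<open>sum_signs_refined_face\<close>), and hence, grouping the faces \<open>F\<close> of \<open>P\<close> by \<open>F i\<close>,
  \<open>(\<Sum>F. (-1) ^ dim F * dim (F i)) = (\<Sum>G. (-1) ^ dim G * dim G)\<close>.

  General position enters through \<open>dim F = (\<Sum>i. dim (F i))\<close>, which passes from the facets of \<open>P\<close>
  to all proper faces because the defect \<open>(\<Sum>i. dim (A i)) - dim (\<Sum>i. A i)\<close> can only shrink when
  the sets \<open>A i\<close> do (\<open>aff_dim_proper_max_face\<close>). Summing the previous identity over \<open>i\<close>, with the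
  terms of \<open>P\<close> and of the \<open>P i\<close> themselves removed, gives the theorem.
\<close>

section \<open>Euler characteristics of relatively open convex sets\<close>

text \<open>
  This is the Euler characteristic with compact supports of a relatively open convex set. It is
  additive over partitions, unlike the ordinary one, which is \<open>1\<close> for every nonempty convex set.
\<close>

definition euler_sign :: "'a::euclidean_space set \<Rightarrow> int"
  where "euler_sign D = (if D = {} then 0 else (-1) ^ nat (aff_dim D))"

text \<open>
  Writing the set as an affine space met with an open set makes it evident that cutting by a
  hyperplane or by an open half-space stays within this class, and it exhibits the dimension.
\<close>

definition relopen_convex :: "'a::euclidean_space set \<Rightarrow> bool"
  where "relopen_convex D \<longleftrightarrow> convex D \<and> (\<exists>L T. affine L \<and> open T \<and> D = L \<inter> T)"

lemma aff_dim_nonneg_iff: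
  fixes S :: "'a::euclidean_space set"
  shows "0 \<le> aff_dim S \<longleftrightarrow> S \<noteq> {}"
  by (metis aff_dim_negative_iff not_less)

lemma relopen_convexI:
  "\<lbrakk>convex D; affine L; open T; D = L \<inter> T\<rbrakk> \<Longrightarrow> relopen_convex D"
  by (auto simp: relopen_convex_def)

lemma aff_dim_affine_Int_open:
  fixes L :: "'a::euclidean_space set"
  assumes "affine L" "open T" "L \<inter> T \<noteq> {}"
  shows "aff_dim (L \<inter> T) = aff_dim L"
  by (metis affine_hull_affine_Int_open aff_dim_affine_hull assms)

lemma relopen_convex_Int_open:
  assumes "relopen_convex D" "open T" "convex T"
  shows "relopen_convex (D \<inter> T)"
proof -
  obtain L T' where "affine L" "open T'" "D = L \<inter> T'" "convex D"
    using assms(1) by (auto simp: relopen_convex_def)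
  then show ?thesis
    using assms by (intro relopen_convexI[of _ L "T' \<inter> T"]) (auto intro: convex_Int)
qed

lemma relopen_convex_Int_affine:
  assumes "relopen_convex D" "affine H"
  shows "relopen_convex (D \<inter> H)"
proof -
  obtain L T' where "affine L" "open T'" "D = L \<inter> T'" "convex D"
    using assms(1) by (auto simp: relopen_convex_def)
  then show ?thesis
    using assms
    by (intro relopen_convexI[of _ "L \<inter> H" T'])
      (auto intro: convex_Int affine_Int affine_imp_convex)
qed

lemma relopen_convex_Int_sgn:
  assumes "relopen_convex D"
  shows "relopen_convex (D \<inter> {x. sgn (a \<bullet> x) = s})"
proof -
  have iff: "(sgn t = 1) = (t > 0)" "(sgn t = 0) = (t = 0)" "(sgn t = -1) = (t < 0)" for t :: real
    by (auto simp: sgn_if)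
  consider "s = 1" | "s = 0" | "s = -1" | "\<forall>t::real. sgn t \<noteq> s"
    by (metis sgn_if)
  then show ?thesis
  proof cases
    case 1
    then show ?thesis
      using relopen_convex_Int_open[OF assms open_halfspace_gt convex_halfspace_gt, of 0 a]
      by (simp add: iff)
  next
    case 2
    then show ?thesis
      using relopen_convex_Int_affine[OF assms affine_hyperplane, of a 0] by (simp add: iff)
  next
    case 3
    then show ?thesis
      using relopen_convex_Int_open[OF assms open_halfspace_lt convex_halfspace_lt, of a 0]
      by (simp add: iff)
  next
    case 4
    then have "D \<inter> {x. sgn (a \<bullet> x) = s} = {}"
      by auto
    then show ?thesis
      by (metis affine_empty convex_empty inf_bot_left open_empty relopen_convexI)
  qed
qed

text \<open>
  If the hyperplane genuinely cuts \<open>D\<close>, the two open sides have the dimension \<open>n\<close> of \<open>D\<close> and the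
  middle piece has dimension \<open>n - 1\<close>, so the signs add up as \<open>1 - 1 + 1 = 1\<close> up to the factor
  \<open>(-1) ^ n\<close>. In all other cases \<open>D\<close> lies in one of the three pieces, by convexity.
\<close>

lemma euler_sign_hyperplane_split:
  assumes "relopen_convex D"
  shows "euler_sign D = (\<Sum>s\<in>{-1, 0, 1}. euler_sign (D \<inter> {x. sgn (a \<bullet> x) = s}))"
proof -
  have iff: "(sgn t = 1) = (t > 0)" "(sgn t = 0) = (t = 0)" "(sgn t = -1) = (t < 0)" for t :: real
    by (auto simp: sgn_if)
  let ?N = "D \<inter> {x. a \<bullet> x < 0}" and ?Z = "D \<inter> {x. a \<bullet> x = 0}" and ?P = "D \<inter> {x. a \<bullet> x > 0}"
  have "euler_sign D = euler_sign ?N + euler_sign ?Z + euler_sign ?P"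
  proof -
    obtain L T where L: "affine L" "open T" "D = L \<inter> T" and "convex D"
      using assms by (auto simp: relopen_convex_def)
    consider "D \<subseteq> {x. a \<bullet> x = 0}" | "?Z = {}" | "?Z \<noteq> {}" "\<not> D \<subseteq> {x. a \<bullet> x = 0}"
      by blast
    then show ?thesis
    proof cases
      case 1
      then have "?N = {}" "?Z = D" "?P = {}"
        by auto
      then show ?thesis
        by (simp add: euler_sign_def)
    next
      case 2
      have "?N = {} \<or> ?P = {}"
      proof (rule ccontr)
        assume "\<not> ?thesis"
        then obtain x y where xy: "x \<in> D" "y \<in> D" "a \<bullet> x < 0" "a \<bullet> y > 0"
          by blast
        then obtain z where "z \<in> D" "a \<bullet> z = 0"
          using connected_ivt_hyperplane[OF convex_connected[OF \<open>convex D\<close>], of x y a 0] by force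
        then show False
          using 2 by blast
      qed
      then show ?thesis
      proof
        assume "?N = {}"
        moreover have "?P = D"
          using 2 calculation by force
        ultimately show ?thesis
          using 2 by (simp add: euler_sign_def)
      next
        assume "?P = {}"
        moreover have "?N = D"
          using 2 calculation by force
        ultimately show ?thesis
          using 2 by (simp add: euler_sign_def)
      qed
    next
      case 3
      then obtain x y where x: "x \<in> D" "a \<bullet> x = 0" and y: "y \<in> D" "a \<bullet> y \<noteq> 0"
        by blast
      obtain e where e: "e > 0" "ball x e \<subseteq> T"
        using x L by (metis IntD2 openE)
      \<comment> \<open>Both points on the line through \<open>x\<close> and \<open>y\<close> at distance \<open>e / 2\<close> from \<open>x\<close> stay in \<open>D\<close>,
        and the functional takes opposite signs on them.\<close>
      define t where "t = e / (2 * norm (y - x))"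
      have "y \<noteq> x"
        using x y by auto
      then have t: "t > 0" "norm (t *\<^sub>R (y - x)) < e"
        using e by (auto simp: t_def)
      have in_D: "x + s *\<^sub>R (y - x) \<in> D" if "\<bar>s\<bar> = t" for s
      proof -
        have "x + s *\<^sub>R (y - x) = (1 - s) *\<^sub>R x + s *\<^sub>R y"
          by (simp add: algebra_simps)
        then have "x + s *\<^sub>R (y - x) \<in> L"
          using x y L by (simp add: affine_alt)
        moreover have "x + s *\<^sub>R (y - x) \<in> ball x e"
          using t that by (simp add: dist_norm)
        ultimately show ?thesis
          using e L by blast
      qed
      have val: "a \<bullet> (x + s *\<^sub>R (y - x)) = s * (a \<bullet> y)" for s
        using x by (simp add: algebra_simps)
      have ne: "?N \<noteq> {} \<and> ?P \<noteq> {}"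
      proof (cases "a \<bullet> y > 0")
        case True
        then have "x + t *\<^sub>R (y - x) \<in> ?P" "x + (- t) *\<^sub>R (y - x) \<in> ?N"
          using in_D[of t] in_D[of "-t"] t val[of t] val[of "-t"] by auto
        then show ?thesis
          by blast
      next
        case False
        then have "a \<bullet> y < 0"
          using y by auto
        then have "x + t *\<^sub>R (y - x) \<in> ?N" "x + (- t) *\<^sub>R (y - x) \<in> ?P"
          using in_D[of t] in_D[of "-t"] t val[of t] val[of "-t"]
          by (auto simp: mult_less_0_iff mult_pos_neg)
        then show ?thesis
          by blast
      qed
      have dD: "aff_dim D = aff_dim L"
        using x L aff_dim_affine_Int_open by blast
      have "?N = L \<inter> (T \<inter> {x. a \<bullet> x < 0})" "?P = L \<inter> (T \<inter> {x. a \<bullet> x > 0})"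
        using L by auto
      then have dN: "aff_dim ?N = aff_dim L" and dP: "aff_dim ?P = aff_dim L"
        using ne L aff_dim_affine_Int_open
        by (metis open_Int open_halfspace_lt, metis open_Int open_halfspace_gt)
      have "?Z = (L \<inter> {x. a \<bullet> x = 0}) \<inter> T"
        using L by auto
      then have "aff_dim ?Z = aff_dim (L \<inter> {x. a \<bullet> x = 0})"
        using 3 L by (metis aff_dim_affine_Int_open affine_Int affine_hyperplane)
      also have "\<dots> = aff_dim L - 1"
        using 3 L by (subst aff_dim_affine_Int_hyperplane) auto
      finally have dZ: "aff_dim ?Z = aff_dim L - 1" .
      have "aff_dim ?Z \<ge> 0"
        using 3 by (simp add: aff_dim_nonneg_iff)
      then have "nat (aff_dim L) = Suc (nat (aff_dim L - 1))"
        using dZ by linarith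
      then show ?thesis
        using 3 ne x(1) by (auto simp: euler_sign_def dD dN dP dZ)
    qed
  qed
  then show ?thesis
    by (simp add: iff)
qed

text \<open>
  Labels that are constant on the sign classes of a finite set \<open>A\<close> of hyperplanes through the origin
  divide \<open>U\<close> into pieces to which additivity applies. The induction removes one hyperplane
  at a time by cutting \<open>U\<close> and all the pieces along it; once no hyperplane is left, the
  label is constant on what remains of \<open>U\<close>, and there is at most one nonempty piece.
\<close>

lemma euler_sign_partition:
  fixes U :: "'a::euclidean_space set" and f :: "'a \<Rightarrow> 'b"
  assumes "finite A" "finite \<Phi>" "relopen_convex U" "f ` U \<subseteq> \<Phi>"
    and "\<And>p. p \<in> \<Phi> \<Longrightarrow> relopen_convex (U \<inter> f -` {p})"
    and "\<And>x y. \<lbrakk>x \<in> U; y \<in> U; \<And>a. a \<in> A \<Longrightarrow> sgn (a \<bullet> x) = sgn (a \<bullet> y)\<rbrakk> \<Longrightarrow> f x = f y"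
  shows "euler_sign U = (\<Sum>p\<in>\<Phi>. euler_sign (U \<inter> f -` {p}))"
  using assms
proof (induction A arbitrary: U rule: finite_induct)
  case empty
  show ?case
  proof (cases "U = {}")
    case True
    then show ?thesis
      by (simp add: euler_sign_def)
  next
    case False
    then obtain x where x: "x \<in> U"
      by blast
    have "U \<subseteq> f -` {f x}"
      using empty.prems(5) x by blast
    then have "U \<inter> f -` {p} = (if p = f x then U else {})" for p
      using x by auto
    then have "euler_sign (U \<inter> f -` {p}) = (if p = f x then euler_sign U else 0)" for p
      by (simp add: euler_sign_def)
    moreover have "f x \<in> \<Phi>"
      using x empty.prems(3) by auto
    ultimately show ?thesis
      using empty.prems(1) by simp
  qed
next
  case (insert a A)
  let ?H = "\<lambda>s. {x. sgn (a \<bullet> x) = s}"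
  have IH: "euler_sign (U \<inter> ?H s) = (\<Sum>p\<in>\<Phi>. euler_sign (U \<inter> ?H s \<inter> f -` {p}))" for s
  proof (rule insert.IH)
    show "relopen_convex (U \<inter> ?H s \<inter> f -` {p})" if "p \<in> \<Phi>" for p
      using relopen_convex_Int_sgn[OF insert.prems(4)[OF that]] by (simp add: Int_ac)
    show "f x = f y"
      if "x \<in> U \<inter> ?H s" "y \<in> U \<inter> ?H s" "\<And>b. b \<in> A \<Longrightarrow> sgn (b \<bullet> x) = sgn (b \<bullet> y)" for x y
      by (rule insert.prems(5)) (use that in auto)
  qed (use insert.prems(1-3) in \<open>auto intro: relopen_convex_Int_sgn\<close>)
  have "euler_sign U = (\<Sum>s\<in>{-1, 0, 1}. \<Sum>p\<in>\<Phi>. euler_sign (U \<inter> ?H s \<inter> f -` {p}))"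
    unfolding IH[symmetric] by (rule euler_sign_hyperplane_split[OF insert.prems(2)])
  also have "\<dots> = (\<Sum>p\<in>\<Phi>. \<Sum>s\<in>{-1, 0, 1}. euler_sign (U \<inter> f -` {p} \<inter> ?H s))"
    by (subst sum.swap) (simp add: Int_ac)
  also have "\<dots> = (\<Sum>p\<in>\<Phi>. euler_sign (U \<inter> f -` {p}))"
    using insert.prems(4) by (intro sum.cong refl euler_sign_hyperplane_split[symmetric]) auto
  finally show ?case .
qed

section \<open>Faces selected by linear functionals\<close>

definition max_face :: "'a::euclidean_space \<Rightarrow> 'a set \<Rightarrow> 'a set"
  where "max_face c S = {x \<in> S. \<forall>y\<in>S. c \<bullet> y \<le> c \<bullet> x}"

definition nonempty_faces :: "'a::euclidean_space set \<Rightarrow> 'a set set"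
  where "nonempty_faces S = {F. F face_of S \<and> F \<noteq> {}}"

lemma max_face_subset: "max_face c S \<subseteq> S"
  by (auto simp: max_face_def)

lemma max_face_zero [simp]: "max_face 0 S = S"
  by (simp add: max_face_def)

lemma max_face_of_subset:
  assumes "A \<subseteq> S" "A \<inter> max_face c S \<noteq> {}"
  shows "max_face c A = A \<inter> max_face c S"
proof -
  obtain z where z: "z \<in> A" "z \<in> max_face c S"
    using assms by blast
  show ?thesis
  proof (intro equalityI subsetI)
    fix x assume x: "x \<in> max_face c A"
    then have "c \<bullet> z \<le> c \<bullet> x"
      using z by (simp add: max_face_def)
    then show "x \<in> A \<inter> max_face c S"
      using x z assms(1) by (fastforce simp: max_face_def)
  qed (use assms(1) in \<open>auto simp: max_face_def\<close>)
qed

lemma max_face_nonempty: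
  assumes "compact S" "S \<noteq> {}"
  shows "max_face c S \<noteq> {}"
proof -
  have "continuous_on S ((\<bullet>) c)"
    by (intro continuous_intros)
  then show ?thesis
    using continuous_attains_sup[OF assms] by (auto simp: max_face_def)
qed

lemma max_face_face_of:
  assumes "convex S"
  shows "max_face c S face_of S"
proof (cases "max_face c S = {}")
  case False
  then obtain x where x: "x \<in> max_face c S"
    by blast
  then have "max_face c S = S \<inter> {y. c \<bullet> y = c \<bullet> x}"
    by (force simp: max_face_def)
  then show ?thesis
    using face_of_Int_supporting_hyperplane_le[OF assms, of c "c \<bullet> x"] x
    unfolding max_face_def by auto
qed auto

lemma max_face_in_nonempty_faces:
  assumes "polytope S" "S \<noteq> {}"
  shows "max_face c S \<in> nonempty_faces S"
  using assms
  by (simp add: nonempty_faces_def max_face_nonempty max_face_face_of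
      polytope_imp_compact polytope_imp_convex)

lemma nonempty_faces_exposed:
  assumes "polytope S" "F \<in> nonempty_faces S"
  obtains c where "max_face c S = F"
proof -
  have "F exposed_face_of S"
    using assms by (simp add: nonempty_faces_def exposed_face_of_polyhedron polytope_imp_polyhedron)
  then obtain c b where c: "S \<subseteq> {x. c \<bullet> x \<le> b}" "F = S \<inter> {x. c \<bullet> x = b}"
    by (auto simp: exposed_face_of_def)
  moreover obtain x where "x \<in> F"
    using assms by (auto simp: nonempty_faces_def)
  ultimately have "max_face c S = F"
    by (force simp: max_face_def)
  then show ?thesis
    using that by blast
qed

lemma finite_nonempty_faces: "polytope S \<Longrightarrow> finite (nonempty_faces S)"
  by (rule finite_subset[OF _ finite_polytope_faces]) (auto simp: nonempty_faces_def)

text \<open>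
  A face of \<open>convex hull V\<close> is the hull of the members of \<open>V\<close> in it, so the selected face is known
  as soon as the maximisers among the finitely many points of \<open>V\<close> are.
\<close>

lemma max_face_convex_hull:
  assumes "finite V"
  shows "max_face c (convex hull V) = convex hull (max_face c V)"
    and "max_face c V = V \<inter> max_face c (convex hull V)"
proof -
  let ?F = "max_face c (convex hull V)"
  have "?F face_of convex hull V"
    by (simp add: max_face_face_of)
  then obtain W where W: "W \<subseteq> V" "?F = convex hull W"
    using assms face_of_convex_hull_subset finite_imp_compact by metis
  have "V \<inter> ?F \<noteq> {}" if "V \<noteq> {}"
  proof -
    have "?F \<noteq> {}"
      using that assms by (intro max_face_nonempty) (auto simp: compact_convex_hull finite_imp_compact)
    then show ?thesis
      using W hull_subset[of W convex] by auto
  qed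
  then show *: "max_face c V = V \<inter> ?F"
    using max_face_of_subset[of V "convex hull V" c] hull_subset[of V convex] 
    by (metis Int_empty_left max_face_subset subset_empty)
  have "W \<subseteq> max_face c V"
    using W hull_subset[of W convex] * by auto
  then have "?F \<subseteq> convex hull (max_face c V)"
    using W by (simp add: hull_mono)
  moreover have "convex hull (max_face c V) \<subseteq> ?F"
    using * \<open>?F face_of convex hull V\<close> by (intro hull_minimal) (auto dest: face_of_imp_convex)
  ultimately show "?F = convex hull (max_face c V)"
    by blast
qed

text \<open>
  This identifies the hyperplanes that separate the regions of the normal fan: those orthogonal to
  differences of generating points.
\<close>

lemma max_face_cong_sgn:
  assumes "finite V" "\<And>v w. \<lbrakk>v \<in> V; w \<in> V\<rbrakk> \<Longrightarrow> sgn ((v - w) \<bullet> c) = sgn ((v - w) \<bullet> c')"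
  shows "max_face c (convex hull V) = max_face c' (convex hull V)"
proof -
  have "(c \<bullet> w \<le> c \<bullet> v) = (c' \<bullet> w \<le> c' \<bullet> v)" if "v \<in> V" "w \<in> V" for v w
    using assms(2)[OF that] inner_commute[of c] inner_commute[of c']
    by (auto simp: inner_diff_left sgn_if split: if_splits)
  then have "max_face c V = max_face c' V"
    by (auto simp: max_face_def)
  then show ?thesis
    using assms max_face_convex_hull by metis
qed

text \<open>
  If \<open>W\<close> is the set of generating points in \<open>F\<close> and \<open>w\<close> is one of them, then \<open>c\<close> selects \<open>F\<close> exactly
  when it is constant on \<open>W\<close> and smaller at the other generating points than at \<open>w\<close>. The first
  condition describes the orthogonal complement of the directions of \<open>F\<close>, the second an open
  convex set.
\<close>

lemma normal_region:
  fixes S :: "'a::euclidean_space set"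
  assumes "polytope S" "F \<in> nonempty_faces S"
  defines "U \<equiv> {c. max_face c S = F}"
  shows "relopen_convex U" "euler_sign U = (-1) ^ nat (int DIM('a) - aff_dim F)"
proof -
  obtain V where V: "finite V" "S = convex hull V"
    using assms by (auto simp: polytope_def)
  obtain c0 where c0: "max_face c0 S = F"
    using assms nonempty_faces_exposed by blast
  define W where "W = max_face c0 V"
  have W: "F = convex hull W" "W \<subseteq> V" "W = V \<inter> F"
    using c0 V max_face_convex_hull max_face_subset unfolding W_def by metis+
  have "W \<noteq> {}"
    using W assms by (auto simp: nonempty_faces_def)
  then obtain w where w: "w \<in> W"
    by blast
  have "max_face c S = F \<longleftrightarrow> max_face c V = W" for c
    using W V max_face_convex_hull by metis
  define L where "L = {c. \<forall>v\<in>W. (v - w) \<bullet> c = 0}"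
  define T where "T = (\<Inter>u\<in>V - W. {c. (w - u) \<bullet> c > 0})"
  have U: "U = L \<inter> T"
  proof -
    have "max_face c V = W \<longleftrightarrow> c \<in> L \<inter> T" for c
    proof
      assume "max_face c V = W"
      then have *: "v \<in> W \<longleftrightarrow> v \<in> V \<and> (\<forall>y\<in>V. c \<bullet> y \<le> c \<bullet> v)" for v
        by (auto simp: max_face_def)
      have "c \<bullet> v = c \<bullet> w" if "v \<in> W" for v
        using *[of v] *[of w] w that by (auto intro: order_antisym)
      moreover have "c \<bullet> u < c \<bullet> w" if "u \<in> V - W" for u
        using *[of u] *[of w] w that by (meson DiffD1 DiffD2 not_less order_trans)
      ultimately show "c \<in> L \<inter> T"
        by (auto simp: L_def T_def inner_commute[of _ c] inner_diff_right)
    next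
      assume "c \<in> L \<inter> T"
      then have eq: "\<And>v. v \<in> W \<Longrightarrow> c \<bullet> v = c \<bullet> w" and lt: "\<And>u. u \<in> V \<Longrightarrow> u \<notin> W \<Longrightarrow> c \<bullet> u < c \<bullet> w"
        by (auto simp: L_def T_def inner_commute[of _ c] inner_diff_right)
      have le: "c \<bullet> u \<le> c \<bullet> w" if "u \<in> V" for u
        using eq lt that by (cases "u \<in> W") (auto intro: less_imp_le)
      show "max_face c V = W"
      proof (intro equalityI subsetI)
        fix v assume "v \<in> max_face c V"
        then have "v \<in> V" "c \<bullet> w \<le> c \<bullet> v"
          using w W(2) by (auto simp: max_face_def)
        then show "v \<in> W"
          using lt[of v] by force
      next
        fix v assume "v \<in> W"
        then show "v \<in> max_face c V"
          using eq[of v] le W(2) by (auto simp: max_face_def)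
      qed
    qed
    then show ?thesis
      using \<open>\<And>c. max_face c S = F \<longleftrightarrow> max_face c V = W\<close> by (auto simp: U_def)
  qed
  have L: "subspace L"
    by (auto simp: L_def subspace_def inner_add_right)
  have T: "open T" "convex T"
    using V by (auto simp: T_def open_halfspace_gt convex_halfspace_gt intro!: open_INT convex_INT)
  have "U \<noteq> {}"
    using c0 by (auto simp: U_def)
  show "relopen_convex U"
    using L T U by (intro relopen_convexI[of _ L T]) 
      (auto intro: convex_Int subspace_imp_convex subspace_imp_affine)
  define D where "D = span ((\<lambda>v. v - w) ` W)"
  have "{c \<in> UNIV. \<forall>x\<in>D. orthogonal x c} = L"
  proof -
    have "L \<subseteq> {c. \<forall>x\<in>D. orthogonal x c}"
    proof safe
      fix c x assume c: "c \<in> L" and "x \<in> D"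
      from \<open>x \<in> D\<close> show "orthogonal x c"
        unfolding D_def orthogonal_def
        by (induction rule: span_induct) (use c in \<open>auto simp: L_def subspace_def inner_add_left\<close>)
    qed
    moreover have "{c. \<forall>x\<in>D. orthogonal x c} \<subseteq> L"
      by (auto simp: L_def D_def orthogonal_def span_base)
    ultimately show ?thesis
      by auto
  qed
  then have "dim L + dim D = DIM('a)"
    using dim_subspace_orthogonal_to_vectors[of D UNIV] by (simp add: D_def)
  moreover have "aff_dim F = int (dim D)"
    using aff_dim_eq_dim_subtract[of w W] w by (simp add: W(1) hull_inc D_def aff_dim_convex_hull)
  moreover have "aff_dim U = int (dim L)"
    using aff_dim_affine_Int_open[of L T] L T U \<open>U \<noteq> {}\<close>
    by (simp add: aff_dim_subspace subspace_imp_affine)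
  ultimately have "aff_dim U = int DIM('a) - aff_dim F"
    by linarith
  then show "euler_sign U = (-1) ^ nat (int DIM('a) - aff_dim F)"
    using \<open>U \<noteq> {}\<close> by (simp add: euler_sign_def)
qed


section \<open>Refinement of normal fans\<close>

lemma minus_one_power_codim:
  assumes "0 \<le> k" "k \<le> int d"
  shows "(-1 :: int) ^ nat (int d - k) = (-1) ^ d * (-1) ^ nat k"
proof -
  have "even (nat (int d - k)) \<longleftrightarrow> even (d + nat k)"
    using assms by (auto simp: even_nat_iff)
  then show ?thesis
    unfolding power_add[symmetric] minus_one_power_iff by simp
qed

text \<open>
  The hypothesis on \<open>\<phi>\<close> says that the normal fan of \<open>P\<close> refines that of \<open>Q\<close>. The normal region of
  \<open>G\<close> is therefore partitioned into the normal regions of the faces \<open>F\<close> of \<open>P\<close> with \<open>\<phi> F = G\<close>, and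
  additivity gives the identity for codimensions; the factor \<open>(-1) ^ d\<close> cancels.
\<close>

lemma sum_signs_refined_face:
  fixes P Q :: "'a::euclidean_space set"
  assumes "polytope P" "P \<noteq> {}" "polytope Q"
    and \<phi>: "\<And>c. \<phi> (max_face c P) = max_face c Q"
    and G: "G \<in> nonempty_faces Q"
  shows "(\<Sum>F | F \<in> nonempty_faces P \<and> \<phi> F = G. (-1) ^ nat (aff_dim F)) = ((-1) ^ nat (aff_dim G) :: int)"
proof -
  let ?d = "DIM('a)" and ?\<Phi> = "{F \<in> nonempty_faces P. \<phi> F = G}"
  let ?f = "\<lambda>c. max_face c P" and ?U = "{c. max_face c Q = G}"
  obtain V where V: "finite V" "P = convex hull V"
    using assms by (auto simp: polytope_def)
  have region: "?U \<inter> ?f -` {F} = {c. max_face c P = F}" if "F \<in> ?\<Phi>" for F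
    using that \<phi> by auto
  have sign: "(-1) ^ nat (int ?d - aff_dim F) = (-1) ^ ?d * ((-1) ^ nat (aff_dim F) :: int)"
    if "F \<noteq> {}" for F :: "'a set"
    using that by (intro minus_one_power_codim) (simp_all add: aff_dim_nonneg_iff aff_dim_le_DIM)
  have "euler_sign ?U = (\<Sum>F\<in>?\<Phi>. euler_sign (?U \<inter> ?f -` {F}))"
  proof (rule euler_sign_partition[where A = "(\<lambda>(v, w). v - w) ` (V \<times> V)"])
    show "?f ` ?U \<subseteq> ?\<Phi>"
      using assms max_face_in_nonempty_faces by auto
    show "relopen_convex (?U \<inter> ?f -` {F})" if "F \<in> ?\<Phi>" for F
      unfolding region[OF that] using assms that by (intro normal_region) auto
    show "?f c = ?f c'"
      if "\<And>a. a \<in> (\<lambda>(v, w). v - w) ` (V \<times> V) \<Longrightarrow> sgn (a \<bullet> c) = sgn (a \<bullet> c')" for c c'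
      unfolding V(2) by (rule max_face_cong_sgn[OF V(1)]) (use that in force)
    show "finite ?\<Phi>"
      using finite_nonempty_faces[OF assms(1)] by simp
  qed (use V(1) assms in \<open>auto intro: normal_region\<close>)
  also have "\<dots> = (\<Sum>F\<in>?\<Phi>. (-1) ^ nat (int ?d - aff_dim F))"
    using assms by (intro sum.cong refl) (subst region, auto intro: normal_region)
  also have "\<dots> = (\<Sum>F\<in>?\<Phi>. (-1) ^ ?d * (-1) ^ nat (aff_dim F))"
    by (intro sum.cong refl sign) (auto simp: nonempty_faces_def)
  also have "\<dots> = (-1) ^ ?d * (\<Sum>F\<in>?\<Phi>. (-1) ^ nat (aff_dim F))"
    by (simp add: sum_distrib_left)
  finally have "(-1) ^ ?d * (-1) ^ nat (aff_dim G) = ((-1) ^ ?d * (\<Sum>F\<in>?\<Phi>. (-1) ^ nat (aff_dim F)) :: int)"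
    using normal_region(2)[OF assms(3) G] sign[of G] G by (simp add: nonempty_faces_def)
  then show ?thesis
    by simp
qed

lemma sum_signs_refinement:
  fixes P Q :: "'a::euclidean_space set" and w :: "'a set \<Rightarrow> int"
  assumes "polytope P" "P \<noteq> {}" "polytope Q" "Q \<noteq> {}"
    and \<phi>: "\<And>c. \<phi> (max_face c P) = max_face c Q"
  shows "(\<Sum>F\<in>nonempty_faces P. (-1) ^ nat (aff_dim F) * w (\<phi> F)) =
    (\<Sum>G\<in>nonempty_faces Q. (-1) ^ nat (aff_dim G) * w G)"
proof -
  have "\<phi> ` nonempty_faces P \<subseteq> nonempty_faces Q"
    using assms by (metis image_subsetI max_face_in_nonempty_faces nonempty_faces_exposed)
  then have "(\<Sum>F\<in>nonempty_faces P. (-1) ^ nat (aff_dim F) * w (\<phi> F)) =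
      (\<Sum>G\<in>nonempty_faces Q. \<Sum>F | F \<in> nonempty_faces P \<and> \<phi> F = G. (-1) ^ nat (aff_dim F) * w (\<phi> F))"
    using assms by (intro sum.group[symmetric]) (auto intro: finite_nonempty_faces)
  also have "\<dots> = (\<Sum>G\<in>nonempty_faces Q.
      (\<Sum>F | F \<in> nonempty_faces P \<and> \<phi> F = G. (-1) ^ nat (aff_dim F)) * w G)"
    unfolding sum_distrib_right by (intro sum.cong refl) auto
  also have "\<dots> = (\<Sum>G\<in>nonempty_faces Q. (-1) ^ nat (aff_dim G) * w G)"
    using assms by (intro sum.cong refl) (simp add: sum_signs_refined_face)
  finally show ?thesis .
qed

section \<open>Minkowski sums\<close>

lemma choose_members:
  assumes "\<And>i. i \<in> I \<Longrightarrow> S i \<noteq> {}"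
  obtains x where "\<And>i. i \<in> I \<Longrightarrow> x i \<in> S i"
  using that[of "\<lambda>i. SOME x. x \<in> S i"] assms by (simp add: some_in_eq)

lemma set_sum_memI: "\<lbrakk>finite I; \<And>i. i \<in> I \<Longrightarrow> x i \<in> S i\<rbrakk> \<Longrightarrow> sum x I \<in> sum S I"
  by (auto simp: set_sum_alt)

lemma set_sum_memE:
  assumes "y \<in> sum S I" "finite I"
  obtains x where "y = sum x I" "\<And>i. i \<in> I \<Longrightarrow> x i \<in> S i"
  using assms by (auto simp: set_sum_alt)

lemma set_sum_nonempty: "\<lbrakk>finite I; \<And>i. i \<in> I \<Longrightarrow> S i \<noteq> {}\<rbrakk> \<Longrightarrow> sum S I \<noteq> {}"
  by (metis choose_members empty_iff set_sum_memI)

lemma set_sum_mono: "\<lbrakk>finite I; \<And>i. i \<in> I \<Longrightarrow> A i \<subseteq> B i\<rbrakk> \<Longrightarrow> sum A I \<subseteq> sum B I"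
  by (fastforce simp: set_sum_alt)

lemma polytope_set_sum:
  fixes S :: "'i \<Rightarrow> 'a::euclidean_space set"
  assumes "finite I" "\<And>i. i \<in> I \<Longrightarrow> polytope (S i)"
  shows "polytope (sum S I)"
  using assms
proof (induction I rule: finite_induct)
  case empty
  then show ?case
    using polytope_sing[of "0 :: 'a"] by (simp add: set_zero)
next
  case (insert i I)
  then have "polytope (S i)" "polytope (sum S I)"
    by auto
  then obtain V W where "finite V" "S i = convex hull V" "finite W" "sum S I = convex hull W"
    unfolding polytope_def by metis
  then have "finite (V + W)" "sum S (insert i I) = convex hull (V + W)"
    using insert.hyps by (simp_all add: convex_hull_set_plus finite_set_plus)
  then show ?case
    unfolding polytope_def by blast
qed

text \<open>
  One coordinate of a maximiser over the sum can be exchanged without changing the others, so it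
  has to be a maximiser over its own summand.
\<close>

lemma sum_mem_max_face_iff:
  fixes S :: "'i \<Rightarrow> 'a::euclidean_space set"
  assumes I: "finite I" and x: "\<And>i. i \<in> I \<Longrightarrow> x i \<in> S i"
  shows "sum x I \<in> max_face c (sum S I) \<longleftrightarrow> (\<forall>i\<in>I. x i \<in> max_face c (S i))"
proof safe
  fix i assume *: "sum x I \<in> max_face c (sum S I)" and i: "i \<in> I"
  show "x i \<in> max_face c (S i)"
    unfolding max_face_def
  proof safe
    fix y assume y: "y \<in> S i"
    have "sum (x(i := y)) I \<in> sum S I"
      using I x y by (intro set_sum_memI) auto
    then have "c \<bullet> sum (x(i := y)) I \<le> c \<bullet> sum x I"
      using * by (auto simp: max_face_def)
    then show "c \<bullet> y \<le> c \<bullet> x i"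
      using I i by (simp add: sum.remove inner_add_right)
  qed (use x i in auto)
next
  assume *: "\<forall>i\<in>I. x i \<in> max_face c (S i)"
  show "sum x I \<in> max_face c (sum S I)"
    unfolding max_face_def
  proof safe
    fix y assume "y \<in> sum S I"
    then obtain z where "y = sum z I" "\<And>i. i \<in> I \<Longrightarrow> z i \<in> S i"
      using I set_sum_memE by blast
    then show "c \<bullet> y \<le> c \<bullet> sum x I"
      using * by (auto simp: inner_sum_right max_face_def intro!: sum_mono)
  qed (use I x in \<open>auto intro: set_sum_memI\<close>)
qed

lemma max_face_set_sum:
  fixes S :: "'i \<Rightarrow> 'a::euclidean_space set"
  assumes "finite I"
  shows "max_face c (sum S I) = (\<Sum>i\<in>I. max_face c (S i))"
proof (intro equalityI subsetI)
  fix y assume y: "y \<in> max_face c (sum S I)"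
  then obtain x where "y = sum x I" "\<And>i. i \<in> I \<Longrightarrow> x i \<in> S i"
    using assms set_sum_memE max_face_subset by (metis in_mono)
  then show "y \<in> (\<Sum>i\<in>I. max_face c (S i))"
    using y assms sum_mem_max_face_iff by (metis set_sum_memI)
next
  fix y assume "y \<in> (\<Sum>i\<in>I. max_face c (S i))"
  then obtain x where x: "y = sum x I" "\<And>i. i \<in> I \<Longrightarrow> x i \<in> max_face c (S i)"
    using assms set_sum_memE by blast
  then show "y \<in> max_face c (sum S I)"
    using sum_mem_max_face_iff[of I x S c] assms max_face_subset by (metis in_mono)
qed

text \<open>
  In particular two functionals that select the same face of the sum select the same face of every
  summand: this is the refinement of normal fans that a Minkowski sum provides.
\<close>

lemma max_face_summand_mono:
  fixes S :: "'i \<Rightarrow> 'a::euclidean_space set"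
  assumes I: "finite I" "i \<in> I"
    and ne: "max_face c (sum S I) \<noteq> {}"
    and sub: "max_face c (sum S I) \<subseteq> max_face c' (sum S I)"
  shows "max_face c (S i) \<subseteq> max_face c' (S i)"
proof
  fix x assume x: "x \<in> max_face c (S i)"
  obtain y where "y \<in> (\<Sum>i\<in>I. max_face c (S i))"
    using ne I by (auto simp: max_face_set_sum)
  then obtain z where z: "\<And>j. j \<in> I \<Longrightarrow> z j \<in> max_face c (S j)"
    using I set_sum_memE by blast
  let ?z = "z(i := x)"
  have *: "?z j \<in> max_face c (S j)" if "j \<in> I" for j
    using x z that by simp
  then have "\<And>j. j \<in> I \<Longrightarrow> ?z j \<in> S j"
    using max_face_subset by blast
  then have "\<forall>j\<in>I. ?z j \<in> max_face c' (S j)"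
    using * sub sum_mem_max_face_iff[OF I(1), of ?z S] by blast
  then show "x \<in> max_face c' (S i)"
    using I by (metis fun_upd_same)
qed

text \<open>
  A cancellation law, proved with support functions. If \<open>y\<close> lies in \<open>M i\<close> but not in \<open>G i\<close>, a
  separating functional is larger at \<open>y\<close> than anywhere on \<open>G i\<close>; then \<open>y\<close> together with maximisers of
  the functional on the other \<open>G j\<close> is a point of \<open>sum M I\<close> beyond the maximum over \<open>sum G I\<close>.
\<close>

lemma summand_eqI_set_sum_subset:
  fixes G M :: "'i \<Rightarrow> 'a::euclidean_space set"
  assumes I: "finite I" "i \<in> I"
    and G: "\<And>j. j \<in> I \<Longrightarrow> compact (G j)" "\<And>j. j \<in> I \<Longrightarrow> G j \<noteq> {}" "convex (G i)"
    and sub: "\<And>j. j \<in> I \<Longrightarrow> G j \<subseteq> M j" "sum M I \<subseteq> sum G I"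
  shows "G i = M i"
proof (rule ccontr)
  assume "G i \<noteq> M i"
  then obtain y where y: "y \<in> M i" "y \<notin> G i"
    using sub I by blast
  then obtain a b where "a \<bullet> y < b" "\<forall>x\<in>G i. a \<bullet> x > b"
    using separating_hyperplane_closed_point[of "G i" y] G I compact_imp_closed by metis
  then have sep: "(- a) \<bullet> x < (- a) \<bullet> y" if "x \<in> G i" for x
    using that by force
  obtain g where g: "\<And>j. j \<in> I \<Longrightarrow> g j \<in> max_face (- a) (G j)"
    by (rule choose_members[of I "\<lambda>j. max_face (- a) (G j)"]) (use G max_face_nonempty in blast)+
  then have gG: "\<And>j. j \<in> I \<Longrightarrow> g j \<in> G j"
    using max_face_subset by blast
  have "sum (g(i := y)) I \<in> sum M I"
    using I gG sub y by (intro set_sum_memI) auto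
  then have "sum (g(i := y)) I \<in> sum G I"
    using sub by blast
  moreover have "sum g I \<in> max_face (- a) (sum G I)"
    using I g gG sum_mem_max_face_iff by metis
  ultimately have "(- a) \<bullet> sum (g(i := y)) I \<le> (- a) \<bullet> sum g I"
    by (auto simp: max_face_def)
  then have "(- a) \<bullet> y \<le> (- a) \<bullet> g i"
    using I by (simp add: sum.remove inner_add_right)
  then show False
    using sep[OF gG[OF I(2)]] by simp
qed

section \<open>Exact decompositions pass to subfaces\<close>

text \<open>
  The defect of a Minkowski sum of two sets is the dimension of the intersection of their
  spaces of directions, which is monotone in both sets.
\<close>

lemma aff_dim_defect_mono2:
  fixes A B A' B' :: "'a::euclidean_space set"
  assumes "A \<noteq> {}" "B \<noteq> {}" "A \<subseteq> A'" "B \<subseteq> B'"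
  shows "aff_dim A + aff_dim B - aff_dim (A + B) \<le> aff_dim A' + aff_dim B' - aff_dim (A' + B')"
proof -
  obtain a b where ab: "a \<in> A" "b \<in> B"
    using assms by blast
  have defect: "aff_dim X + aff_dim Y - aff_dim (X + Y) =
      int (dim (span ((\<lambda>x. x - a) ` X) \<inter> span ((\<lambda>y. y - b) ` Y)))"
    if "a \<in> X" "b \<in> Y" for X Y
  proof -
    let ?X = "(\<lambda>x. x - a) ` X" and ?Y = "(\<lambda>y. y - b) ` Y" and ?Z = "(\<lambda>z. z - (a + b)) ` (X + Y)"
    have "?X \<union> ?Y \<subseteq> ?Z"
    proof -
      have "x - a = (x + b) - (a + b)" "y - b = (a + y) - (a + b)" for x y
        by auto
      then show ?thesis
        using that by (blast intro: set_plus_intro)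
    qed
    moreover have "?Z \<subseteq> span (?X \<union> ?Y)"
    proof
      fix z assume "z \<in> ?Z"
      then obtain x y where xy: "x \<in> X" "y \<in> Y" "z = (x - a) + (y - b)"
        by (auto simp: set_plus_def)
      then show "z \<in> span (?X \<union> ?Y)"
        by (auto intro!: span_add intro: span_base)
    qed
    ultimately have "span ?Z = span (?X \<union> ?Y)"
      by (metis span_eq span_superset order_trans)
    then have "dim ?Z = dim (span (?X \<union> ?Y))"
      by (metis dim_span)
    then have "dim ?Z = dim {x + y |x y. x \<in> span ?X \<and> y \<in> span ?Y}"
      by (simp only: span_Un)
    moreover have "dim {x + y |x y. x \<in> span ?X \<and> y \<in> span ?Y} + dim (span ?X \<inter> span ?Y) = dim ?X + dim ?Y"
      using dim_sums_Int[of "span ?X" "span ?Y"] by simp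
    moreover have "aff_dim X = int (dim ?X)" "aff_dim Y = int (dim ?Y)" "aff_dim (X + Y) = int (dim ?Z)"
      using that by (auto intro!: aff_dim_eq_dim_subtract hull_inc)
    ultimately show ?thesis
      by linarith
  qed
  have "dim (span ((\<lambda>x. x - a) ` A) \<inter> span ((\<lambda>y. y - b) ` B)) \<le>
      dim (span ((\<lambda>x. x - a) ` A') \<inter> span ((\<lambda>y. y - b) ` B'))"
    using assms by (intro dim_subset Int_mono span_mono image_mono)
  then show ?thesis
    using defect[of A B] defect[of A' B'] ab assms by (metis of_nat_mono subsetD)
qed

lemma aff_dim_defect_mono:
  fixes A B :: "'i \<Rightarrow> 'a::euclidean_space set"
  assumes "finite I" "\<And>i. i \<in> I \<Longrightarrow> A i \<noteq> {}" "\<And>i. i \<in> I \<Longrightarrow> A i \<subseteq> B i"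
  shows "(\<Sum>i\<in>I. aff_dim (A i)) - aff_dim (sum A I) \<le> (\<Sum>i\<in>I. aff_dim (B i)) - aff_dim (sum B I)"
  using assms
proof (induction I rule: finite_induct)
  case (insert i I)
  have "aff_dim (A i) + aff_dim (sum A I) - aff_dim (A i + sum A I) \<le>
      aff_dim (B i) + aff_dim (sum B I) - aff_dim (B i + sum B I)"
    using insert by (intro aff_dim_defect_mono2 set_sum_nonempty set_sum_mono) auto
  moreover have "(\<Sum>i\<in>I. aff_dim (A i)) - aff_dim (sum A I) \<le> (\<Sum>i\<in>I. aff_dim (B i)) - aff_dim (sum B I)"
    using insert by simp
  ultimately show ?case
    using insert.hyps by simp
qed simp

text \<open>
  Subadditivity is the comparison of the defect with the defect \<open>0\<close> of a family of singletons.
\<close>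

lemma aff_dim_set_sum_le:
  fixes A :: "'i \<Rightarrow> 'a::euclidean_space set"
  assumes "finite I" "\<And>i. i \<in> I \<Longrightarrow> A i \<noteq> {}"
  shows "aff_dim (sum A I) \<le> (\<Sum>i\<in>I. aff_dim (A i))"
proof -
  obtain p where p: "\<And>i. i \<in> I \<Longrightarrow> p i \<in> A i"
    using assms(2) by (rule choose_members) blast+
  have "(\<Sum>i\<in>I. {p i}) = {sum p I}"
    using assms by (auto simp: set_sum_alt intro!: sum.cong)
  then show ?thesis
    using aff_dim_defect_mono[of I "\<lambda>i. {p i}" A] p assms by simp
qed

lemma aff_dim_exact_mono:
  fixes A B :: "'i \<Rightarrow> 'a::euclidean_space set"
  assumes "finite I" "\<And>i. i \<in> I \<Longrightarrow> A i \<noteq> {}" "\<And>i. i \<in> I \<Longrightarrow> A i \<subseteq> B i"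
    and "aff_dim (sum B I) = (\<Sum>i\<in>I. aff_dim (B i))"
  shows "aff_dim (sum A I) = (\<Sum>i\<in>I. aff_dim (A i))"
proof -
  have "(\<Sum>i\<in>I. aff_dim (A i)) - aff_dim (sum A I) \<le> (\<Sum>i\<in>I. aff_dim (B i)) - aff_dim (sum B I)"
    using assms(1-3) by (rule aff_dim_defect_mono)
  moreover have "aff_dim (sum A I) \<le> (\<Sum>i\<in>I. aff_dim (A i))"
    using assms(1,2) by (rule aff_dim_set_sum_le)
  ultimately show ?thesis
    using assms(4) by linarith
qed

text \<open>
  This is the uniqueness of decompositions: every decomposition of the face that \<open>c\<close> selects consists
  of the faces of the summands that \<open>c\<close> selects.
\<close>

lemma decomposition_eq_max_face:
  fixes P :: "nat \<Rightarrow> 'a::euclidean_space set"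
  assumes P: "\<And>i. i \<in> {1..r} \<Longrightarrow> polytope (P i)"
    and dec: "decomposition r P (max_face c (\<Sum>i\<in>{1..r}. P i)) G" and i: "i \<in> {1..r}"
  shows "G i = max_face c (P i)"
proof -
  have G: "G j face_of P j" "G j \<noteq> {}" if "j \<in> {1..r}" for j
    using dec that by (auto simp: decomposition_def)
  have GP: "G j \<subseteq> P j" if "j \<in> {1..r}" for j
    using G that face_of_imp_subset by blast
  have eq: "(\<Sum>i\<in>{1..r}. G i) = (\<Sum>i\<in>{1..r}. max_face c (P i))"
    using dec by (simp add: decomposition_def max_face_set_sum)
  show ?thesis
  proof (rule summand_eqI_set_sum_subset[of "{1..r}" i G "\<lambda>i. max_face c (P i)"])
    show "compact (G j)" if "j \<in> {1..r}" for j
      using P G that by (meson face_of_polytope_polytope polytope_imp_compact)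
    show "convex (G i)"
      using G i face_of_imp_convex by blast
    show "G j \<subseteq> max_face c (P j)" if j: "j \<in> {1..r}" for j
    proof
      fix x assume x: "x \<in> G j"
      obtain g where g: "\<And>k. k \<in> {1..r} \<Longrightarrow> g k \<in> G k"
        using G(2) by (rule choose_members) blast+
      let ?g = "g(j := x)"
      have *: "\<And>k. k \<in> {1..r} \<Longrightarrow> ?g k \<in> G k"
        using g x by simp
      then have "sum ?g {1..r} \<in> (\<Sum>i\<in>{1..r}. G i)"
        by (intro set_sum_memI) auto
      then have "sum ?g {1..r} \<in> max_face c (\<Sum>i\<in>{1..r}. P i)"
        by (simp only: eq max_face_set_sum[OF finite_atLeastAtMost])
      then have "\<forall>k\<in>{1..r}. ?g k \<in> max_face c (P k)"
        using * GP by (subst (asm) sum_mem_max_face_iff) blast+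
      then show "x \<in> max_face c (P j)"
        using j by (metis fun_upd_same)
    qed
  qed (use i eq G in auto)
qed

text \<open>
  A proper face lies in a facet, whose decomposition is exact by general position. The summands
  of the smaller face lie in those of the facet, so that the defect of the smaller face is also \<open>0\<close>.
\<close>

lemma aff_dim_proper_max_face:
  fixes P :: "nat \<Rightarrow> 'a::euclidean_space set"
  assumes P: "\<And>i. i \<in> {1..r} \<Longrightarrow> polytope (P i)" "\<And>i. i \<in> {1..r} \<Longrightarrow> P i \<noteq> {}"
    and gen: "relatively_in_general_position r P"
    and proper: "max_face c (\<Sum>i\<in>{1..r}. P i) \<noteq> (\<Sum>i\<in>{1..r}. P i)"
  shows "aff_dim (max_face c (\<Sum>i\<in>{1..r}. P i)) = (\<Sum>i\<in>{1..r}. aff_dim (max_face c (P i)))"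
proof -
  let ?S = "\<Sum>i\<in>{1..r}. P i"
  have S: "polytope ?S" "?S \<noteq> {}"
    using polytope_set_sum[of "{1..r}" P] set_sum_nonempty[of "{1..r}" P] P by blast+
  then have F: "max_face c ?S face_of ?S" "max_face c ?S \<noteq> {}"
    using max_face_in_nonempty_faces by (auto simp: nonempty_faces_def)
  then obtain H where H: "H facet_of ?S" "max_face c ?S \<subseteq> H"
    using face_of_polyhedron_subset_facet[OF polytope_imp_polyhedron] S proper by metis
  then obtain G where G: "exact_decomposition r P H G"
    using gen by (auto simp: relatively_in_general_position_def)
  have "H \<in> nonempty_faces ?S"
    using H by (auto simp: nonempty_faces_def facet_of_def)
  then obtain c' where c': "max_face c' ?S = H"
    using S nonempty_faces_exposed by blast
  have GH: "decomposition r P (max_face c' ?S) G" "aff_dim H = (\<Sum>i\<in>{1..r}. aff_dim (G i))"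
    using G c' by (auto simp: exact_decomposition_def)
  have sub: "max_face c (P i) \<subseteq> max_face c' (P i)" if "i \<in> {1..r}" for i
    using max_face_summand_mono[of "{1..r}" i c P c'] that F H c' by auto
  have "aff_dim (\<Sum>i\<in>{1..r}. max_face c' (P i)) = (\<Sum>i\<in>{1..r}. aff_dim (max_face c' (P i)))"
    using GH c' decomposition_eq_max_face[OF P(1) GH(1)] by (simp add: max_face_set_sum)
  moreover have "max_face c (P i) \<noteq> {}" if "i \<in> {1..r}" for i
    using P[OF that] by (intro max_face_nonempty polytope_imp_compact)
  ultimately have "aff_dim (\<Sum>i\<in>{1..r}. max_face c (P i)) = (\<Sum>i\<in>{1..r}. aff_dim (max_face c (P i)))"
    using aff_dim_exact_mono[of "{1..r}" "\<lambda>i. max_face c (P i)" "\<lambda>i. max_face c' (P i)"] sub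
    by blast
  then show ?thesis
    by (simp only: max_face_set_sum[OF finite_atLeastAtMost])
qed

section \<open>The alternating sum of the face numbers\<close>

lemma sum_face_count_eq:
  fixes Q :: "'a::euclidean_space set"
  assumes "polytope Q" "aff_dim Q = int DIM('a)"
  shows "(\<Sum>k = 0..DIM('a) - 1. (-1) ^ k * int k * int (face_count k Q)) =
    (\<Sum>F\<in>nonempty_faces Q - {Q}. (-1) ^ nat (aff_dim F) * aff_dim F)"
proof -
  let ?h = "\<lambda>F :: 'a set. (-1) ^ nat (aff_dim F) * aff_dim F" and ?N = "nonempty_faces Q - {Q}"
  have dim: "0 \<le> aff_dim F \<and> aff_dim F < int DIM('a)" if "F \<in> ?N" for F
    using that face_of_aff_dim_lt[of Q F] assms
    by (auto simp: nonempty_faces_def aff_dim_nonneg_iff polytope_imp_convex)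
  have fiber: "{F \<in> ?N. nat (aff_dim F) = k} = {F. F face_of Q \<and> aff_dim F = int k}"
    if k: "k < DIM('a)" for k
  proof (intro Collect_cong iffI)
    fix F assume F: "F \<in> ?N \<and> nat (aff_dim F) = k"
    then have "aff_dim F = int k"
      using dim[of F] by auto
    then show "F face_of Q \<and> aff_dim F = int k"
      using F by (simp add: nonempty_faces_def)
  next
    fix F assume F: "F face_of Q \<and> aff_dim F = int k"
    then have "F \<noteq> {}" "F \<noteq> Q"
      using k assms(2) by auto
    then show "F \<in> ?N \<and> nat (aff_dim F) = k"
      using F by (simp add: nonempty_faces_def)
  qed
  have "(\<Sum>F\<in>?N. ?h F) = (\<Sum>k\<in>{0..DIM('a) - 1}. \<Sum>F | F \<in> ?N \<and> nat (aff_dim F) = k. ?h F)"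
  proof (rule sum.group[symmetric])
    show "finite ?N"
      using assms by (simp add: finite_nonempty_faces)
    show "(\<lambda>F. nat (aff_dim F)) ` ?N \<subseteq> {0..DIM('a) - 1}"
    proof (rule image_subsetI)
      fix F assume "F \<in> ?N"
      then show "nat (aff_dim F) \<in> {0..DIM('a) - 1}"
        using dim[of F] by auto
    qed
  qed simp
  also have "\<dots> = (\<Sum>k\<in>{0..DIM('a) - 1}. \<Sum>F | F face_of Q \<and> aff_dim F = int k. (-1) ^ k * int k)"
  proof (rule sum.cong[OF refl])
    fix k assume "k \<in> {0..DIM('a) - 1}"
    then have "k < DIM('a)"
      using DIM_positive[where 'a = 'a] unfolding atLeastAtMost_iff by linarith
    show "(\<Sum>F | F \<in> ?N \<and> nat (aff_dim F) = k. ?h F) =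
        (\<Sum>F | F face_of Q \<and> aff_dim F = int k. (-1) ^ k * int k)"
    proof (rule sum.cong)
      show "{F \<in> ?N. nat (aff_dim F) = k} = {F. F face_of Q \<and> aff_dim F = int k}"
        using \<open>k < DIM('a)\<close> by (rule fiber)
    qed simp
  qed
  also have "\<dots> = (\<Sum>k = 0..DIM('a) - 1. (-1) ^ k * int k * int (face_count k Q))"
    by (simp add: face_count_def mult.commute)
  finally show ?thesis
    by simp
qed

theorem theorem2:
  fixes P :: "nat \<Rightarrow> 'a::euclidean_space set" and r :: nat
  assumes "r \<ge> 1"
    and "\<And>i. i \<in> {1..r} \<Longrightarrow> polytope (P i)"
    and "\<And>i. i \<in> {1..r} \<Longrightarrow> aff_dim (P i) = int DIM('a)"
    and "relatively_in_general_position r P"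
  shows "(\<Sum>k = 0..DIM('a) - 1. (-1) ^ k * int k * f_delta r k (\<Sum>i\<in>{1..r}. P i) P) = 0"
proof -
  let ?d = "DIM('a)" and ?I = "{1..r}"
  define S where "S = (\<Sum>i\<in>?I. P i)"
  let ?h = "\<lambda>F :: 'a set. (-1) ^ nat (aff_dim F) * aff_dim F"
  have ne: "P i \<noteq> {}" if "i \<in> ?I" for i
    using assms(3)[OF that] by auto
  have S: "polytope S" "S \<noteq> {}"
    using polytope_set_sum[of ?I P] set_sum_nonempty[of ?I P] assms ne unfolding S_def by blast+
  \<comment> \<open>\<open>\<phi> i F\<close> is the summand \<open>F i\<close> in the decomposition of \<open>F\<close>; the choice of the functional
    that selects \<open>F\<close> does not affect it.\<close>
  define \<phi> where "\<phi> i F = max_face (SOME c. max_face c S = F) (P i)" for i F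
  have \<phi>: "\<phi> i (max_face c S) = max_face c (P i)" if "i \<in> ?I" for i c
  proof -
    define c' where "c' = (SOME c'. max_face c' S = max_face c S)"
    have "max_face c' S = max_face c S"
      unfolding c'_def by (rule someI) simp
    moreover have "max_face c S \<noteq> {}"
      using S by (intro max_face_nonempty polytope_imp_compact)
    ultimately have "max_face c' (P i) = max_face c (P i)"
      using max_face_summand_mono[of ?I i c' P c] max_face_summand_mono[of ?I i c P c'] that
      unfolding S_def by blast
    then show ?thesis
      by (simp add: \<phi>_def c'_def)
  qed
  have \<phi>_S: "\<phi> i S = P i" if "i \<in> ?I" for i
    using \<phi>[OF that, of 0] by simp
  have dim_S: "aff_dim S = int ?d"
  proof -
    obtain p where p: "\<And>i. i \<in> ?I \<Longrightarrow> p i \<in> P i"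
      using ne by (rule choose_members) blast+
    \<comment> \<open>\<open>S\<close> contains a translate of the full-dimensional \<open>P 1\<close>.\<close>
    let ?q = "sum p (?I - {1})"
    have "(+) ?q ` P 1 \<subseteq> P 1 + sum P (?I - {1})"
      using p by (auto simp: add.commute intro!: set_plus_intro set_sum_memI)
    also have "\<dots> = S"
      unfolding S_def by (rule sum.remove[symmetric]) (use assms(1) in auto)
    finally have "aff_dim (P 1) \<le> aff_dim S"
      by (metis aff_dim_subset aff_dim_translation_eq)
    then show ?thesis
      using assms(1,3) aff_dim_le_DIM[of S] by force
  qed
  have S_face: "S \<in> nonempty_faces S"
    using max_face_in_nonempty_faces[OF S, of 0] by simp
  have fin: "finite (nonempty_faces S)"
    using S by (intro finite_nonempty_faces)
  \<comment> \<open>The terms for \<open>S\<close> and for \<open>P i\<close> agree, since both polytopes have full dimension and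
    \<open>\<phi> i S = P i\<close>; they are dropped from the two sides.\<close>
  have summand: "(\<Sum>F\<in>nonempty_faces S - {S}. (-1) ^ nat (aff_dim F) * aff_dim (\<phi> i F)) =
      (\<Sum>G\<in>nonempty_faces (P i) - {P i}. ?h G)" if i: "i \<in> ?I" for i
  proof -
    have "P i \<in> nonempty_faces (P i)"
      using max_face_in_nonempty_faces[of "P i" 0] assms ne i by simp
    moreover have "(\<Sum>F\<in>nonempty_faces S. (-1) ^ nat (aff_dim F) * aff_dim (\<phi> i F)) =
        (\<Sum>G\<in>nonempty_faces (P i). ?h G)"
      using S assms ne i \<phi> by (intro sum_signs_refinement) auto
    ultimately show ?thesis
      using assms i fin S_face \<phi>_S dim_S by (simp add: sum_diff1 finite_nonempty_faces)
  qed
  have "(\<Sum>F\<in>nonempty_faces S - {S}. ?h F) =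
      (\<Sum>F\<in>nonempty_faces S - {S}. \<Sum>i\<in>?I. (-1) ^ nat (aff_dim F) * aff_dim (\<phi> i F))"
  proof (intro sum.cong refl)
    fix F assume F: "F \<in> nonempty_faces S - {S}"
    then obtain c where c: "max_face c S = F"
      using S nonempty_faces_exposed by blast
    then have "aff_dim F = (\<Sum>i\<in>?I. aff_dim (\<phi> i F))"
      using aff_dim_proper_max_face[OF assms(2) ne assms(4), of c] F \<phi>[of _ c] by (auto simp: S_def)
    then show "?h F = (\<Sum>i\<in>?I. (-1) ^ nat (aff_dim F) * aff_dim (\<phi> i F))"
      by (simp add: sum_distrib_left)
  qed
  also have "\<dots> = (\<Sum>i\<in>?I. \<Sum>G\<in>nonempty_faces (P i) - {P i}. ?h G)"
    by (subst sum.swap) (simp add: summand)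
  also have "\<dots> = (\<Sum>i\<in>?I. \<Sum>k = 0..?d - 1. (-1) ^ k * int k * int (face_count k (P i)))"
    using assms by (intro sum.cong refl sum_face_count_eq[symmetric])
  finally have "(\<Sum>k = 0..?d - 1. (-1) ^ k * int k * int (face_count k S)) =
      (\<Sum>i\<in>?I. \<Sum>k = 0..?d - 1. (-1) ^ k * int k * int (face_count k (P i)))"
    unfolding sum_face_count_eq[OF S(1) dim_S] .
  then show ?thesis
    unfolding f_delta_def S_def[symmetric]
    by (simp add: right_diff_distrib sum_subtractf sum_distrib_left) (rule sum.swap)
qed

end
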